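(* Let $k$ be a field, $S=k[x_1,\dots,x_n]$ a standard graded polynomial ring, and $I=(x_{i_1},\dots,x_{i_t})^d$, where $1\le i_1<\dots<i_t\le n$ and $d\ge 2$. Then every graded algebra retract of $S/I$ has a base.
   Context: All rings are Noetherian, commutative with unit, and nonzero; $k$ is an arbitrary field of any characteristic. Let $S=k[x_1,\dots,x_n]$ be standard graded with $S_+=(x_1,\dots,x_n)$, and let $I\subseteq (S_+)^2$ be a monomial ideal. A graded algebra retract of $S/I$ is a graded $k$-algebra $A$ together with degree-preserving $k$-algebra homomorphisms $\theta:A\to S/I$ and $S/I\to A$ (the retraction map) whose composition $A\to S/I\to A$ is the identity. Such an $A$ is a standard graded $k$-algebra, and one writes $A=R/J$ with $R$ a standard graded polynomial ring over $k$ and $J\subseteq (R_+)^2$ a graded ideal (the minimal presentation, unique up to isomorphism). Since $I\subseteq (S_+)^2$ and $J\subseteq (R_+)^2$, the two maps are induced by unique degree-preserving $k$-algebra homomorphisms $R\to S$ and $\phi:S\to R$ with composition $R\to S\to R$ equal to the identity; regarding $R$ as a subring of $S$, one has $\phi(I)=J=I\cap R$. For $W\subseteq[n]=\{1,\dots,n\}$ let $S_W=k[x_i:i\in W]$ and let $I_W\subseteq S_W$ be the ideal of $S_W$ generated by the monomials of $I$ that are products of variables in $S_W$. A subset $W\subseteq[n]$ is a base of the retract $\theta:R/J\to S/I$ if (1) the elements $\phi(x_i)$, $i\in W$, of $R_1$ are linearly independent over $k$, and (2) $\phi(I)=\phi(I_WS)$. *)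

theory Defs
  imports
    "HOL-Library.Poly_Mapping"
    "HOL-Algebra.Module"
    "HOL-Algebra.QuotRing"
    "HOL-Algebra.Ideal_Product"
    "HOL-Algebra.Algebraic_Closure_Type"
begin

section \<open>Graded algebras over a field\<close>

text \<open>
  The ground field is a type \<open>'k :: field\<close>; \<^const>\<open>ring_of_type_algebra\<close> turns it into a ring
  record, so that a \<open>'k\<close>-algebra is a record \<open>A\<close> with \<open>algebra ring_of_type_algebra A\<close>.
  A grading is given by its family of homogeneous components, indexed by the natural numbers.
\<close>

definition graded_algebra :: "('k::field, 'a) module \<Rightarrow> (nat \<Rightarrow> 'a set) \<Rightarrow> bool" where
  "graded_algebra A G \<longleftrightarrow>
     algebra (ring_of_type_algebra :: 'k ring) A \<and>
     (\<forall>i. submodule (G i) (ring_of_type_algebra :: 'k ring) A) \<and>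
     (\<forall>i j. \<forall>x\<in>G i. \<forall>y\<in>G j. x \<otimes>\<^bsub>A\<^esub> y \<in> G (i + j)) \<and>
     (\<forall>x\<in>carrier A. \<exists>!f. (\<forall>i. f i \<in> G i) \<and> finite {i. f i \<noteq> \<zero>\<^bsub>A\<^esub>} \<and>
        x = (\<Oplus>\<^bsub>A\<^esub>i\<in>{i. f i \<noteq> \<zero>\<^bsub>A\<^esub>}. f i))"

definition graded_alg_hom ::
  "('k::field, 'a) module \<Rightarrow> (nat \<Rightarrow> 'a set) \<Rightarrow> ('k, 'b) module \<Rightarrow> (nat \<Rightarrow> 'b set) \<Rightarrow> ('a \<Rightarrow> 'b) set" where
  "graded_alg_hom A G B H =
     {f \<in> ring_hom A B. (\<forall>c. \<forall>x\<in>carrier A. f (c \<odot>\<^bsub>A\<^esub> x) = c \<odot>\<^bsub>B\<^esub> f x) \<and> (\<forall>i. f ` G i \<subseteq> H i)}"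

definition homogeneous_ideal :: "('k, 'a) module \<Rightarrow> (nat \<Rightarrow> 'a set) \<Rightarrow> 'a set \<Rightarrow> bool" where
  "homogeneous_ideal A G I \<longleftrightarrow> ideal I A \<and> I = Idl\<^bsub>A\<^esub> (I \<inter> (\<Union>i. G i))"

definition ideal_power :: "('k, 'a) module \<Rightarrow> 'a set \<Rightarrow> nat \<Rightarrow> 'a set" where
  "ideal_power A I d = I [^]\<^bsub>ideals_set A\<^esub> d"

definition quot_alg :: "('k, 'a) module \<Rightarrow> 'a set \<Rightarrow> ('k, 'a set) module" where
  "quot_alg A I =
     \<lparr>carrier = carrier (A Quot I), monoid.mult = monoid.mult (A Quot I), one = one (A Quot I),
      zero = zero (A Quot I), add = add (A Quot I),
      module.smult = (\<lambda>c Y. \<Union>x\<in>Y. I +>\<^bsub>A\<^esub> (c \<odot>\<^bsub>A\<^esub> x))\<rparr>"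

definition quot_grading :: "('k, 'a) module \<Rightarrow> (nat \<Rightarrow> 'a set) \<Rightarrow> 'a set \<Rightarrow> nat \<Rightarrow> 'a set set" where
  "quot_grading A G I i = (\<lambda>x. I +>\<^bsub>A\<^esub> x) ` G i"


section \<open>Standard graded polynomial rings\<close>

text \<open>
  Polynomials are finitely supported maps from exponent vectors to coefficients.
  \<open>poly_alg V\<close> is the polynomial ring over \<open>'k\<close> in the variables with index in \<open>V\<close>.
\<close>

type_synonym 'k mpoly = "(nat \<Rightarrow>\<^sub>0 nat) \<Rightarrow>\<^sub>0 'k"

definition poly_alg :: "nat set \<Rightarrow> ('k::field, 'k mpoly) module" where
  "poly_alg V =
     \<lparr>carrier = {p. \<forall>t\<in>Poly_Mapping.keys p. Poly_Mapping.keys t \<subseteq> V}, monoid.mult = (*), one = 1,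
      zero = 0, add = (+), module.smult = (\<lambda>c p. Poly_Mapping.single 0 c * p)\<rparr>"

definition mon :: "(nat \<Rightarrow>\<^sub>0 nat) \<Rightarrow> 'k::field mpoly" where
  "mon t = Poly_Mapping.single t 1"

definition var :: "nat \<Rightarrow> 'k::field mpoly" where
  "var i = mon (Poly_Mapping.single i 1)"

definition mon_deg :: "(nat \<Rightarrow>\<^sub>0 nat) \<Rightarrow> nat" where
  "mon_deg t = (\<Sum>i\<in>Poly_Mapping.keys t. Poly_Mapping.lookup t i)"

definition poly_grading :: "nat set \<Rightarrow> nat \<Rightarrow> 'k::field mpoly set" where
  "poly_grading V d = {p \<in> carrier (poly_alg V). \<forall>t\<in>Poly_Mapping.keys p. mon_deg t = d}"

definition var_ideal :: "nat set \<Rightarrow> nat set \<Rightarrow> 'k::field mpoly set" where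
  "var_ideal V T = Idl\<^bsub>poly_alg V\<^esub> (var ` T)"

text \<open>The ideal \<open>I\<^sub>W\<close> of \<open>S\<^sub>W\<close>.\<close>

definition restrict_ideal :: "'k::field mpoly set \<Rightarrow> nat set \<Rightarrow> 'k mpoly set" where
  "restrict_ideal I W = Idl\<^bsub>poly_alg W\<^esub> {mon t | t. Poly_Mapping.keys t \<subseteq> W \<and> mon t \<in> I}"


section \<open>Algebra retracts and bases\<close>

text \<open>Throughout, \<open>S = poly_alg {1..n}\<close>, and \<open>I\<close> is an ideal of \<open>S\<close>.\<close>

abbreviation quot_poly :: "nat \<Rightarrow> 'k::field mpoly set \<Rightarrow> ('k, 'k mpoly set) module" where
  "quot_poly n I \<equiv> quot_alg (poly_alg {1..n}) I"

abbreviation quot_poly_grading :: "nat \<Rightarrow> 'k::field mpoly set \<Rightarrow> nat \<Rightarrow> 'k mpoly set set" where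
  "quot_poly_grading n I \<equiv> quot_grading (poly_alg {1..n}) (poly_grading {1..n}) I"

text \<open>\<open>\<pi>\<close> is the retraction map.\<close>

definition graded_retract ::
  "nat \<Rightarrow> 'k::field mpoly set \<Rightarrow> ('k, 'a) module \<Rightarrow> (nat \<Rightarrow> 'a set) \<Rightarrow>
     ('a \<Rightarrow> 'k mpoly set) \<Rightarrow> ('k mpoly set \<Rightarrow> 'a) \<Rightarrow> bool" where
  "graded_retract n I A G \<theta> \<pi> \<longleftrightarrow>
     graded_algebra A G \<and>
     \<theta> \<in> graded_alg_hom A G (quot_poly n I) (quot_poly_grading n I) \<and>
     \<pi> \<in> graded_alg_hom (quot_poly n I) (quot_poly_grading n I) A G \<and>
     (\<forall>a\<in>carrier A. \<pi> (\<theta> a) = a)"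

text \<open>
  \<open>A \<cong> R/J\<close> via \<open>\<eta>\<close>, where \<open>R\<close> is the polynomial ring in \<open>m\<close> variables and \<open>J \<subseteq> (R\<^sub>+)\<^sup>2\<close> is graded.
\<close>

definition minimal_presentation ::
  "('k::field, 'a) module \<Rightarrow> (nat \<Rightarrow> 'a set) \<Rightarrow> nat \<Rightarrow> 'k mpoly set \<Rightarrow> ('k mpoly set \<Rightarrow> 'a) \<Rightarrow> bool" where
  "minimal_presentation A G m J \<eta> \<longleftrightarrow>
     homogeneous_ideal (poly_alg {1..m}) (poly_grading {1..m}) J \<and>
     J \<subseteq> ideal_power (poly_alg {1..m}) (var_ideal {1..m} {1..m}) 2 \<and>
     \<eta> \<in> graded_alg_hom (quot_poly m J) (quot_poly_grading m J) A G \<and>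
     bij_betw \<eta> (carrier (quot_poly m J)) (carrier A)"

text \<open>\<open>\<phi> : S \<rightarrow> R\<close> induces the retraction map \<open>S/I \<rightarrow> R/J \<cong> A\<close>.\<close>

definition induces_retraction ::
  "nat \<Rightarrow> 'k::field mpoly set \<Rightarrow> nat \<Rightarrow> 'k mpoly set \<Rightarrow> ('k mpoly set \<Rightarrow> 'a) \<Rightarrow>
     ('k mpoly set \<Rightarrow> 'a) \<Rightarrow> ('k mpoly \<Rightarrow> 'k mpoly) \<Rightarrow> bool" where
  "induces_retraction n I m J \<eta> \<pi> \<phi> \<longleftrightarrow>
     \<phi> \<in> graded_alg_hom (poly_alg {1..n}) (poly_grading {1..n})
                         (poly_alg {1..m}) (poly_grading {1..m}) \<and>
     (\<forall>p\<in>carrier (poly_alg {1..n}). 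
        \<eta> (J +>\<^bsub>poly_alg {1..m}\<^esub> \<phi> p) = \<pi> (I +>\<^bsub>poly_alg {1..n}\<^esub> p))"

text \<open>
  Minimal presentations are unique up to isomorphism and, given one, \<open>\<phi>\<close> is unique on \<open>S\<close>, so
  the property of \<open>W\<close> below does not depend on the choice of \<open>m\<close>, \<open>J\<close>, \<open>\<eta>\<close> and \<open>\<phi>\<close>.
  \<open>I\<^sub>W S\<close> is the ideal of \<open>S\<close> generated by \<open>I\<^sub>W\<close>.
\<close>

definition retract_base ::
  "nat \<Rightarrow> 'k::field mpoly set \<Rightarrow> ('k, 'a) module \<Rightarrow> (nat \<Rightarrow> 'a set) \<Rightarrow>
     ('k mpoly set \<Rightarrow> 'a) \<Rightarrow> nat set \<Rightarrow> bool" where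
  "retract_base n I A G \<pi> W \<longleftrightarrow>
     W \<subseteq> {1..n} \<and>
     (\<exists>m J \<eta> \<phi>. minimal_presentation A G m J \<eta> \<and> induces_retraction n I m J \<eta> \<pi> \<phi> \<and>
        (\<forall>c. (\<Oplus>\<^bsub>poly_alg {1..m}\<^esub>i\<in>W. c i \<odot>\<^bsub>poly_alg {1..m}\<^esub> \<phi> (var i)) = \<zero>\<^bsub>poly_alg {1..m}\<^esub> \<longrightarrow>
             (\<forall>i\<in>W. c i = 0)) \<and>
        \<phi> ` I = \<phi> ` (Idl\<^bsub>poly_alg {1..n}\<^esub> (restrict_ideal I W)))"

end

theory Submission
  imports Defs
begin

text \<open>
  Write \<open>P = (x\<^sub>i : i \<in> T)\<close>, so \<open>I = P\<^sup>d\<close>, and let \<open>K\<close> be the kernel of \<open>S \<rightarrow> S/I \<rightarrow> A\<close>. Choose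
  \<open>W\<^sub>1 \<subseteq> T\<close> maximal such that the variables in \<open>W\<^sub>1\<close> are linearly independent modulo \<open>K\<close>, and extend
  it to such a maximal \<open>W \<subseteq> {1..n}\<close>. Then \<open>A\<close> is minimally presented over a polynomial ring \<open>R\<close>
  with one variable for each element of \<open>W\<close>, and \<open>\<phi>\<close> sends \<open>x\<^sub>i\<close> to its expansion in \<open>W\<close> modulo
  \<open>K\<close>, which involves only variables in \<open>W\<^sub>1\<close> when \<open>i \<in> T\<close>. Let \<open>\<psi> : R \<rightarrow> S\<^sub>W \<subseteq> S\<close> be the
  section of \<open>\<phi>\<close> that renames the variables. The composition \<open>\<sigma> = \<psi> \<circ> \<phi>\<close> maps \<open>P\<close> into itself, hence
  it maps \<open>I\<close> into \<open>I \<inter> S\<^sub>W = I\<^sub>W\<close>, and \<open>\<phi> p = \<phi> (\<sigma> p)\<close> lies in \<open>\<phi>(I\<^sub>W S)\<close> for \<open>p \<in> I\<close>.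
\<close>

section \<open>Substitution in polynomials\<close>

abbreviation const :: "'k \<Rightarrow> 'k::field mpoly" where
  "const c \<equiv> Poly_Mapping.single 0 c"

definition monom_subst :: "(nat \<Rightarrow> 'k::field mpoly) \<Rightarrow> (nat \<Rightarrow>\<^sub>0 nat) \<Rightarrow> 'k mpoly" where
  "monom_subst g t = (\<Prod>i\<in>Poly_Mapping.keys t. g i ^ Poly_Mapping.lookup t i)"

text \<open>All polynomials live in one type with infinitely many variables, so a single operator
  serves for every map between polynomial rings; source and target are recorded by carriers.\<close>

definition subst :: "(nat \<Rightarrow> 'k::field mpoly) \<Rightarrow> 'k mpoly \<Rightarrow> 'k mpoly" where
  "subst g p = (\<Sum>t\<in>Poly_Mapping.keys p. const (Poly_Mapping.lookup p t) * monom_subst g t)"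

text \<open>The weight is a parameter so that one additivity law covers the total degree (all
  weights 1) and the degree in the variables of \<open>T\<close> (indicator weights).\<close>

definition wdeg :: "(nat \<Rightarrow> nat) \<Rightarrow> (nat \<Rightarrow>\<^sub>0 nat) \<Rightarrow> nat" where
  "wdeg w t = (\<Sum>i\<in>Poly_Mapping.keys t. w i * Poly_Mapping.lookup t i)"

text \<open>Subrings in fewer variables, graded pieces and powers of a variable ideal all have this
  form, so closure statements reduce to statements on exponents.\<close>

definition supported :: "('t \<Rightarrow> bool) \<Rightarrow> ('t \<Rightarrow>\<^sub>0 'a::zero) set" where
  "supported P = {p. \<forall>t\<in>Poly_Mapping.keys p. P t}"

lemma keys_add_nat:
  "Poly_Mapping.keys (s + t) = Poly_Mapping.keys s \<union> Poly_Mapping.keys (t :: nat \<Rightarrow>\<^sub>0 nat)"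
  by (auto simp: in_keys_iff lookup_add)

lemma poly_mapping_sum_monomials:
  "p = (\<Sum>t\<in>Poly_Mapping.keys p. Poly_Mapping.single t (Poly_Mapping.lookup p t))"

  by (rule poly_mapping_eqI)
    (auto simp: lookup_sum lookup_single when_def in_keys_iff sum.delta)

lemma monom_subst_superset:
  assumes "finite B" "Poly_Mapping.keys t \<subseteq> B"
  shows "monom_subst g t = (\<Prod>i\<in>B. g i ^ Poly_Mapping.lookup t i)"
  unfolding monom_subst_def
  by (rule prod.mono_neutral_left) (use assms in \<open>auto simp: in_keys_iff\<close>)

lemma monom_subst_add: "monom_subst g (s + t) = monom_subst g s * monom_subst g t"
proof -
  let ?B = "Poly_Mapping.keys s \<union> Poly_Mapping.keys t"
  have "monom_subst g u = (\<Prod>i\<in>?B. g i ^ Poly_Mapping.lookup u i)" if "u \<in> {s, t, s + t}" for u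
    by (rule monom_subst_superset) (use that in \<open>auto simp: keys_add_nat\<close>)
  then show ?thesis
    by (simp add: lookup_add power_add prod.distrib)
qed

lemma monom_subst_single [simp]: "monom_subst g (Poly_Mapping.single i k) = g i ^ k"
  by (auto simp: monom_subst_def)

lemma monom_subst_zero [simp]: "monom_subst g 0 = 1"
  by (simp add: monom_subst_def)

lemma wdeg_superset:
  assumes "finite B" "Poly_Mapping.keys t \<subseteq> B"
  shows "wdeg w t = (\<Sum>i\<in>B. w i * Poly_Mapping.lookup t i)"
  unfolding wdeg_def
  by (rule sum.mono_neutral_left) (use assms in \<open>auto simp: in_keys_iff\<close>)

lemma wdeg_add: "wdeg w (s + t) = wdeg w s + wdeg w t"
proof -
  let ?B = "Poly_Mapping.keys s \<union> Poly_Mapping.keys t"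
  have "wdeg w u = (\<Sum>i\<in>?B. w i * Poly_Mapping.lookup u i)" if "u \<in> {s, t, s + t}" for u
    by (rule wdeg_superset) (use that in \<open>auto simp: keys_add_nat\<close>)
  then show ?thesis
    by (simp add: lookup_add distrib_left sum.distrib)
qed

lemma wdeg_single [simp]: "wdeg w (Poly_Mapping.single i k) = w i * k"
  by (auto simp: wdeg_def)

lemma wdeg_zero [simp]: "wdeg w 0 = 0"
  by (simp add: wdeg_def)

lemma mon_deg_eq_wdeg: "mon_deg = wdeg (\<lambda>_. 1)"
  by (auto simp: mon_deg_def wdeg_def)

lemma subst_superset:
  assumes "finite B" "Poly_Mapping.keys p \<subseteq> B"
  shows "subst g p = (\<Sum>t\<in>B. const (Poly_Mapping.lookup p t) * monom_subst g t)"
  unfolding subst_def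
  by (rule sum.mono_neutral_left) (use assms in \<open>auto simp: in_keys_iff\<close>)

lemma subst_add: "subst g (p + q) = subst g p + subst g q"
proof -
  let ?B = "Poly_Mapping.keys p \<union> Poly_Mapping.keys q"
  have "subst g u = (\<Sum>t\<in>?B. const (Poly_Mapping.lookup u t) * monom_subst g t)"
    if "u \<in> {p, q, p + q}" for u
    by (rule subst_superset) (use that keys_add[of p q] in auto)
  then show ?thesis
    by (simp add: lookup_add single_add distrib_right sum.distrib)
qed

lemma subst_single: "subst g (Poly_Mapping.single t a) = const a * monom_subst g t"
  by (cases "a = 0") (auto simp: subst_def)

lemma subst_zero [simp]: "subst g 0 = 0"
  by (simp add: subst_def)

lemma subst_sum: "subst g (sum f B) = (\<Sum>x\<in>B. subst g (f x))"
  by (induction B rule: infinite_finite_induct) (auto simp: subst_add)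

lemma subst_mult: "subst g (p * q) = subst g p * subst g q"
proof -
  have "subst g (p * q) = subst g ((\<Sum>s\<in>Poly_Mapping.keys p. Poly_Mapping.single s (Poly_Mapping.lookup p s))
      * (\<Sum>t\<in>Poly_Mapping.keys q. Poly_Mapping.single t (Poly_Mapping.lookup q t)))"
    by (simp flip: poly_mapping_sum_monomials)
  \<comment> \<open>Read from right to left, \<open>mult_single\<close> at exponent 0 splits the
    constant of a product into a product of constants; what remains is reordering.\<close>
  also have "\<dots> = subst g p * subst g q"
    unfolding sum_product subst_sum mult_single subst_single
    unfolding subst_def sum_product
    by (simp add: monom_subst_add flip: mult_single[of 0 _ 0, simplified] mult.assoc)
      (simp add: ac_simps)
  finally show ?thesis .
qed

lemma subst_const [simp]: "subst g (const c) = const c"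
  by (simp add: subst_single)

lemma subst_one [simp]: "subst g 1 = 1"
  using subst_const[of g 1] by simp

lemma subst_var [simp]: "subst g (var i) = g i"
  by (simp add: var_def mon_def subst_single)

section \<open>Subspaces spanned by monomials\<close>

lemma supported_zero [simp]: "0 \<in> supported P"
  by (simp add: supported_def)

lemma supported_add: "p \<in> supported P \<Longrightarrow> q \<in> supported P \<Longrightarrow> p + q \<in> supported P"
  using keys_add[of p q] by (auto simp: supported_def)

lemma supported_uminus: "p \<in> supported P \<Longrightarrow> - p \<in> supported P"
  for p :: "'t \<Rightarrow>\<^sub>0 'a::ab_group_add"
  by (auto simp: supported_def in_keys_iff)

lemma supported_sum: "(\<And>x. x \<in> B \<Longrightarrow> f x \<in> supported P) \<Longrightarrow> sum f B \<in> supported P"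
  by (induction B rule: infinite_finite_induct) (auto simp: supported_add)

lemma supported_single: "P t \<Longrightarrow> Poly_Mapping.single t a \<in> supported P"
  by (cases "a = 0") (auto simp: supported_def)

lemma supported_mult:
  assumes "p \<in> supported P" "q \<in> supported Q" "\<And>s t. P s \<Longrightarrow> Q t \<Longrightarrow> R (s + t)"
  shows "p * q \<in> supported R"
  using keys_mult[of p q] assms unfolding supported_def by blast

lemma supported_const_mult: "p \<in> supported P \<Longrightarrow> const c * p \<in> supported P"
  by (rule supported_mult[of _ "\<lambda>t. t = 0"]) (auto intro: supported_single)

lemma supported_mono: "p \<in> supported P \<Longrightarrow> (\<And>t. P t \<Longrightarrow> Q t) \<Longrightarrow> p \<in> supported Q"
  by (auto simp: supported_def)

lemma supported_one: "P 0 \<Longrightarrow> (1 :: 't::zero \<Rightarrow>\<^sub>0 'a::zero_neq_one) \<in> supported P"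
  by (simp add: supported_def)

text \<open>\<open>P\<close> is a family indexed by degree and compatible with products, like a
  grading or a filtration. Each factor contributes its own index, and the indices add up to the
  weighted degree. It is used with equality of total degree and with a lower bound on the degree in
  \<open>T\<close>.\<close>

lemma monom_subst_supported:
  assumes one: "P 0 0"
    and add: "\<And>a b s t. P a s \<Longrightarrow> P b t \<Longrightarrow> P (a + b) (s + t)"
    and g: "\<And>i. i \<in> Poly_Mapping.keys t \<Longrightarrow> g i \<in> supported (P (w i))"
  shows "monom_subst g t \<in> supported (P (wdeg w t))"
proof -
  have pow: "g i ^ k \<in> supported (P (w i * k))" if "i \<in> Poly_Mapping.keys t" for i k
  proof (induction k)
    case (Suc k)
    then show ?case
      using supported_mult[OF g[OF that] Suc, of "P (w i * Suc k)"] by (auto dest: add)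
  qed (simp add: supported_one one)
  have "(\<Prod>i\<in>B. g i ^ Poly_Mapping.lookup t i) \<in> supported (P (\<Sum>i\<in>B. w i * Poly_Mapping.lookup t i))"
    if "finite B" "B \<subseteq> Poly_Mapping.keys t" for B
    using that
  proof (induction B rule: finite_induct)
    case (insert x B)
    then show ?case
      by (auto intro!: supported_mult[OF pow] add)
  qed (simp add: supported_one one)
  from this[of "Poly_Mapping.keys t"] show ?thesis
    by (simp add: monom_subst_def wdeg_def)
qed

lemma subst_supported:
  assumes "p \<in> supported P" "\<And>t. P t \<Longrightarrow> monom_subst g t \<in> supported Q"
  shows "subst g p \<in> supported Q"
  unfolding subst_def
  by (intro supported_sum supported_const_mult) (use assms in \<open>auto simp: supported_def\<close>)


section \<open>Polynomial algebras\<close>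

lemma poly_alg_simps [simp]:
  "monoid.mult (poly_alg V) = (*)" "one (poly_alg V) = 1" "zero (poly_alg V) = 0"
  "add (poly_alg V) = (+)" "c \<odot>\<^bsub>poly_alg V\<^esub> p = const c * p"
  by (simp_all add: poly_alg_def)

lemma carrier_poly_alg: "carrier (poly_alg V) = supported (\<lambda>t. Poly_Mapping.keys t \<subseteq> V)"
  by (simp add: poly_alg_def supported_def)

lemma poly_grading_eq:
  "poly_grading V d = supported (\<lambda>t. Poly_Mapping.keys t \<subseteq> V \<and> mon_deg t = d)"
  by (auto simp: poly_grading_def carrier_poly_alg supported_def)

lemma poly_alg_mult_closed:
  "p \<in> carrier (poly_alg V) \<Longrightarrow> q \<in> carrier (poly_alg V) \<Longrightarrow> p * q \<in> carrier (poly_alg V)"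
  unfolding carrier_poly_alg by (erule supported_mult, assumption) (simp add: keys_add_nat)

lemma poly_alg_add_closed:
  "p \<in> carrier (poly_alg V) \<Longrightarrow> q \<in> carrier (poly_alg V) \<Longrightarrow> p + q \<in> carrier (poly_alg V)"
  unfolding carrier_poly_alg by (rule supported_add)

lemma const_closed [simp]: "const c \<in> carrier (poly_alg V)"
  by (simp add: carrier_poly_alg supported_single)

lemma var_closed [simp]: "var i \<in> carrier (poly_alg V) \<longleftrightarrow> i \<in> V"
  by (auto simp: carrier_poly_alg supported_def var_def mon_def)

lemma cring_poly_alg: "cring (poly_alg V :: ('k::field, 'k mpoly) module)"
  (is "cring ?R")
proof (rule cringI)
  show "abelian_group ?R"
  proof (rule abelian_groupI)
    fix x :: "'k mpoly" assume "x \<in> carrier (poly_alg V)"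
    then show "\<exists>y\<in>carrier (poly_alg V). y \<oplus>\<^bsub>poly_alg V\<^esub> x = \<zero>\<^bsub>poly_alg V\<^esub>"
      by (intro bexI[of _ "- x"]) (auto simp: carrier_poly_alg intro: supported_uminus)
  qed (auto simp: carrier_poly_alg supported_add add_ac)
  show "Group.comm_monoid ?R"
    by (rule comm_monoidI)
      (auto intro: poly_alg_mult_closed[unfolded carrier_poly_alg]
        simp: mult_ac carrier_poly_alg supported_one)
qed (simp add: distrib_right)

lemma uminus_poly_alg [simp]:
  assumes "p \<in> carrier (poly_alg V)"
  shows "\<ominus>\<^bsub>poly_alg V\<^esub> p = - p"
proof -
  interpret cring "poly_alg V" by (rule cring_poly_alg)
  have "- p \<in> carrier (poly_alg V)"
    using assms by (simp add: carrier_poly_alg supported_uminus)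
  then show ?thesis
    using assms minus_equality[of "- p" p] by simp
qed

lemma finsum_poly_alg:
  assumes "f \<in> B \<rightarrow> carrier (poly_alg V)" "finite B"
  shows "(\<Oplus>\<^bsub>poly_alg V\<^esub>i\<in>B. f i) = sum f B"
proof -
  interpret cring "poly_alg V" by (rule cring_poly_alg)
  show ?thesis
    using assms(2,1) by (induction B rule: finite_induct) auto
qed

text \<open>Weights are natural numbers and add under products, so multiplication cannot lower the
  weighted degree of a term. With indicator weights these are the powers of a variable
  ideal.\<close>

lemma ideal_supported:
  "ideal (supported (\<lambda>t. Poly_Mapping.keys t \<subseteq> V \<and> d \<le> wdeg w t) :: 'k::field mpoly set)
    (poly_alg V)" (is "ideal ?F _")
proof -
  interpret cring "poly_alg V" by (rule cring_poly_alg)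
  have sub: "?F \<subseteq> carrier (poly_alg V)"
    unfolding carrier_poly_alg by (auto intro: supported_mono)
  have absorb: "x * a \<in> ?F" if "a \<in> ?F" "x \<in> carrier (poly_alg V)" for a x :: "'k mpoly"
    by (rule supported_mult[OF that(2)[unfolded carrier_poly_alg] that(1)])
      (auto simp: keys_add_nat wdeg_add)
  show ?thesis
  proof (rule idealI[OF ring_axioms])
    show "subgroup ?F (add_monoid (poly_alg V))"
    proof (rule add.subgroupI[OF sub])
      fix a :: "'k mpoly" assume "a \<in> ?F"
      then show "\<ominus>\<^bsub>poly_alg V\<^esub> a \<in> ?F"
        using sub by (subst uminus_poly_alg) (auto intro: supported_uminus)
    next
      have "0 \<in> ?F" by simp
      then show "?F \<noteq> {}" by blast
    qed (auto intro: supported_add)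
  next
    fix a x :: "'k mpoly" assume *: "a \<in> ?F" "x \<in> carrier (poly_alg V)"
    show "x \<otimes>\<^bsub>poly_alg V\<^esub> a \<in> ?F" using absorb[OF *] by simp
    show "a \<otimes>\<^bsub>poly_alg V\<^esub> x \<in> ?F" using absorb[OF *] by (simp add: mult.commute)
  qed
qed

section \<open>Monomials and membership in ideals\<close>

lemma mon_0 [simp]: "mon 0 = 1"
  by (simp add: mon_def)

lemma mon_mult: "mon s * mon t = mon (s + t)"
  by (simp add: mon_def mult_single)

lemma single_eq_const_mult_mon: "Poly_Mapping.single t a = const a * mon t"
  by (simp add: mon_def mult_single)

lemma ideal_sum:
  assumes "ideal I (poly_alg V)" "\<And>x. x \<in> B \<Longrightarrow> f x \<in> I"
  shows "sum f B \<in> I"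
proof -
  interpret ideal I "poly_alg V" by fact
  have zero: "0 \<in> I" and add: "a \<in> I \<Longrightarrow> b \<in> I \<Longrightarrow> a + b \<in> I" for a b
    using additive_subgroup.zero_closed additive_subgroup.a_closed is_additive_subgroup by force+
  show ?thesis
    using assms(2) by (induction B rule: infinite_finite_induct) (auto simp: zero add)
qed

text \<open>A polynomial is the sum of its terms and an ideal absorbs coefficients. Inclusions of
  monomial ideals can thus be checked on monomials.\<close>

lemma ideal_contains_supported:
  assumes "ideal I (poly_alg V)" "p \<in> supported P"
    and "\<And>t. P t \<Longrightarrow> mon t \<in> I"
  shows "p \<in> I"
proof -
  interpret ideal I "poly_alg V" by fact
  have "Poly_Mapping.single t (Poly_Mapping.lookup p t) \<in> I" if "t \<in> Poly_Mapping.keys p" for t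
    using I_l_closed[of "mon t"] that assms(2,3)
    by (auto simp: supported_def single_eq_const_mult_mon[of t])
  from ideal_sum[OF assms(1) this, of "Poly_Mapping.keys p" "\<lambda>t. t"] show ?thesis
    by (simp flip: poly_mapping_sum_monomials)
qed

lemma mon_single_add: "mon (Poly_Mapping.single i 1 + s) = var i * mon s"
  by (simp add: var_def mon_mult)

text \<open>Subtraction of exponents is truncated; it is exact here since the exponent of
  \<open>i\<close> is positive.\<close>

lemma in_keys_split_single:
  fixes t :: "nat \<Rightarrow>\<^sub>0 nat"
  assumes "i \<in> Poly_Mapping.keys t"
  obtains s where "t = Poly_Mapping.single i 1 + s"
proof
  show "t = Poly_Mapping.single i 1 + (t - Poly_Mapping.single i 1)"
    by (rule poly_mapping_eqI)
      (use assms in \<open>auto simp: lookup_add lookup_minus lookup_single when_def in_keys_iff\<close>)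
qed

section \<open>Ideals generated by variables and their powers\<close>

abbreviation deg_in :: "nat set \<Rightarrow> (nat \<Rightarrow>\<^sub>0 nat) \<Rightarrow> nat" where
  "deg_in T \<equiv> wdeg (\<lambda>i. of_bool (i \<in> T))"

lemma deg_in_pos_iff: "deg_in T t > 0 \<longleftrightarrow> (\<exists>i\<in>Poly_Mapping.keys t. i \<in> T)"
  unfolding wdeg_def neq0_conv[symmetric] by (subst sum_eq_0_iff) (auto simp: in_keys_iff)

text \<open>A monomial of positive degree in \<open>T\<close> is divisible by some
  \<open>x_i\<close> with \<open>i\<close> in \<open>T\<close>; conversely, the right side is an
  ideal containing these variables.\<close>

lemma var_ideal_eq:
  assumes "T \<subseteq> V"
  shows "var_ideal V T = supported (\<lambda>t. Poly_Mapping.keys t \<subseteq> V \<and> 1 \<le> deg_in T t)" (is "_ = ?F")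
proof
  interpret cring "poly_alg V" by (rule cring_poly_alg)
  have vars: "var ` T \<subseteq> carrier (poly_alg V)"
    using assms by auto
  interpret P: ideal "var_ideal V T" "poly_alg V"
    unfolding var_ideal_def using vars by (rule genideal_ideal)
  show "var_ideal V T \<subseteq> ?F"
    unfolding var_ideal_def
    by (rule genideal_minimal[OF ideal_supported])
      (use assms in \<open>auto simp: var_def mon_def intro!: supported_single\<close>)
  show "?F \<subseteq> var_ideal V T"
  proof (rule subsetI, rule ideal_contains_supported[OF P.ideal_axioms])
    fix t assume t: "Poly_Mapping.keys t \<subseteq> V \<and> 1 \<le> deg_in T t"
    then obtain i where i: "i \<in> Poly_Mapping.keys t" "i \<in> T"
      using deg_in_pos_iff[of T t] by auto
    obtain s where s: "t = Poly_Mapping.single i 1 + s"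
      using in_keys_split_single[OF i(1)] by blast
    have "mon s \<in> carrier (poly_alg V)"
      using t s by (auto simp: carrier_poly_alg mon_def keys_add_nat intro!: supported_single)
    moreover have "var i \<in> var_ideal V T"
      using i genideal_self[OF vars] by (auto simp: var_ideal_def)
    ultimately show "mon t \<in> var_ideal V T"
      using P.I_r_closed by (simp add: s mon_single_add del: One_nat_def)
  qed assumption
qed

lemma ideal_power_0 [simp]: "ideal_power R I 0 = carrier R"
  by (simp add: ideal_power_def nat_pow_def ideals_set_def)

lemma ideal_power_Suc: "ideal_power R I (Suc d) = ideal_prod R (ideal_power R I d) I"
  by (simp add: ideal_power_def nat_pow_def ideals_set_def)

text \<open>Induction on \<open>d\<close>: degrees in \<open>T\<close> add under products, and a
  monomial of degree at least \<open>d + 1\<close> in \<open>T\<close> splits off one variable of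
  \<open>T\<close>, leaving degree at least \<open>d\<close>.\<close>

lemma ideal_power_var_ideal:
  assumes "T \<subseteq> V"
  shows "ideal_power (poly_alg V) (var_ideal V T :: 'k::field mpoly set) d
    = supported (\<lambda>t. Poly_Mapping.keys t \<subseteq> V \<and> d \<le> deg_in T t)"
proof (induction d)
  case 0
  then show ?case by (simp add: carrier_poly_alg)
next
  case (Suc d)
  interpret cring "poly_alg V" by (rule cring_poly_alg)
  let ?F = "\<lambda>d. supported (\<lambda>t. Poly_Mapping.keys t \<subseteq> V \<and> d \<le> deg_in T t) :: 'k mpoly set"
  have id: "ideal (?F d) (poly_alg V)" for d
    by (rule ideal_supported)
  have "ideal_prod (poly_alg V) (?F d) (?F 1) = ?F (Suc d)"
  proof
    show "ideal_prod (poly_alg V) (?F d) (?F 1) \<subseteq> ?F (Suc d)"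
    proof
      fix p assume "p \<in> ideal_prod (poly_alg V) (?F d) (?F 1)"
      then show "p \<in> ?F (Suc d)"
      proof induction
        case (prod p q)
        show ?case
          unfolding poly_alg_simps
          by (rule supported_mult[OF prod]) (auto simp: keys_add_nat wdeg_add)
      qed (simp add: supported_add)
    qed
    show "?F (Suc d) \<subseteq> ideal_prod (poly_alg V) (?F d) (?F 1)"
    proof (rule subsetI, rule ideal_contains_supported[OF ideal_prod_is_ideal[OF id id]])
      fix t assume t: "Poly_Mapping.keys t \<subseteq> V \<and> Suc d \<le> deg_in T t"
      then obtain i where i: "i \<in> Poly_Mapping.keys t" "i \<in> T"
        using deg_in_pos_iff[of T t] by auto
      obtain s where s: "t = Poly_Mapping.single i 1 + s"
        using in_keys_split_single[OF i(1)] by blast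
      have "mon s \<in> ?F d" "var i \<in> ?F 1"
        unfolding var_def mon_def
        by (rule supported_single; use t s i in \<open>auto simp: keys_add_nat wdeg_add\<close>)+
      then show "mon t \<in> ideal_prod (poly_alg V) (?F d) (?F 1)"
        using ideal_prod.prod[of "mon s" _ "var i" _ "poly_alg V"] by (simp add: s mon_single_add mult.commute del: One_nat_def)
    qed assumption
  qed
  then show ?case
    unfolding ideal_power_Suc Suc.IH by (simp add: var_ideal_eq[OF assms])
qed


section \<open>Linear forms modulo a subspace\<close>

definition lin_form :: "nat set \<Rightarrow> (nat \<Rightarrow> 'k) \<Rightarrow> 'k::field mpoly" where
  "lin_form W c = (\<Sum>j\<in>W. const (c j) * var j)"

text \<open>For \<open>K\<close> the kernel of a linear map, this is linear independence of the
  images of the variables in \<open>W\<close>.\<close>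

definition indep_mod :: "'k::field mpoly set \<Rightarrow> nat set \<Rightarrow> bool" where
  "indep_mod K W \<longleftrightarrow> (\<forall>c. lin_form W c \<in> K \<longrightarrow> (\<forall>i\<in>W. c i = 0))"

lemma lin_form_superset:
  assumes "finite W" "U \<subseteq> W"
  shows "lin_form U c = lin_form W (\<lambda>j. if j \<in> U then c j else 0)"
proof -
  have "lin_form W (\<lambda>j. if j \<in> U then c j else 0) = (\<Sum>j\<in>W. if j \<in> U then const (c j) * var j else 0)"
    unfolding lin_form_def by (rule sum.cong) auto
  also have "\<dots> = lin_form U c"
    using assms by (simp add: lin_form_def Int_absorb1 flip: sum.inter_restrict)
  finally show ?thesis by simp
qed

lemma lin_form_mult: "const a * lin_form W c = lin_form W (\<lambda>j. a * c j)"
  by (simp add: lin_form_def sum_distrib_left mult_single flip: mult.assoc)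

text \<open>A maximal independent set between \<open>U\<close> and \<open>B\<close> works: a further
  index creates a relation in which the new variable must occur, and solving for it gives the
  expansion.\<close>

lemma indep_mod_extend:
  assumes smult: "\<And>a p. p \<in> K \<Longrightarrow> const a * p \<in> K"
    and "finite B" "U \<subseteq> B" "indep_mod K U"
  obtains W where "U \<subseteq> W" "W \<subseteq> B" "indep_mod K W"
    "\<And>i. i \<in> B - W \<Longrightarrow> \<exists>c. var i - lin_form W c \<in> K"
proof -
  let ?C = "{W. U \<subseteq> W \<and> W \<subseteq> B \<and> indep_mod K W}"
  have "finite ?C"
    by (rule finite_subset[of _ "Pow B"]) (use assms(2) in auto)
  moreover have "U \<in> ?C"
    using assms(3,4) by blast
  ultimately obtain W where W: "W \<in> ?C" and max: "\<And>W'. W' \<in> ?C \<Longrightarrow> W \<subseteq> W' \<Longrightarrow> W = W'"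
    using finite_has_maximal[of ?C] by (metis (no_types, lifting) empty_iff)
  show ?thesis
  proof (rule that)
    fix i assume i: "i \<in> B - W"
    then have "\<not> indep_mod K (insert i W)"
      using max[of "insert i W"] W by auto
    then obtain c j where c: "lin_form (insert i W) c \<in> K" "j \<in> insert i W" "c j \<noteq> 0"
      by (auto simp: indep_mod_def)
    have fin: "finite W"
      using W assms(2) by (auto intro: finite_subset)
    have eq: "lin_form (insert i W) c = const (c i) * var i + lin_form W c"
      using fin i by (simp add: lin_form_def)
    \<comment> \<open>Without the new variable, the relation would be one inside the independent set
      \<open>W\<close>.\<close>
    have "c i \<noteq> 0"
    proof
      assume "c i = 0"
      with eq c(1) have "lin_form W c \<in> K" by simp
      with W c(2,3) \<open>c i = 0\<close> show False by (auto simp: indep_mod_def)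
    qed
    have "const (inverse (c i)) * lin_form (insert i W) c \<in> K"
      using c(1) by (rule smult)
    also have "const (inverse (c i)) * lin_form (insert i W) c
      = var i + lin_form W (\<lambda>j. inverse (c i) * c j)"
      using \<open>c i \<noteq> 0\<close> by (simp add: eq distrib_left mult_single lin_form_mult flip: mult.assoc)
    also have "\<dots> = var i - lin_form W (\<lambda>j. - (inverse (c i) * c j))"
      by (simp add: lin_form_def single_uminus sum_negf)
    finally show "\<exists>c. var i - lin_form W c \<in> K" by blast
  qed (use W in auto)
qed

text \<open>The set is built in two stages, first inside \<open>T\<close> and then inside
  \<open>B\<close>. Variables of \<open>T\<close> outside \<open>W\<close> expand in the first stage
  alone, so their coefficients vanish outside \<open>T\<close>; this is what lets the later
  substitution respect the ideal of \<open>T\<close>.\<close>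

lemma adapted_basis:
  assumes smult: "\<And>a p. p \<in> K \<Longrightarrow> const a * p \<in> K" and "0 \<in> K"
    and "finite B" "T \<subseteq> B"
  obtains W c where "W \<subseteq> B" "indep_mod K W"
    "\<And>i. i \<in> B \<Longrightarrow> var i - lin_form W (c i) \<in> K"
    "\<And>i. i \<in> W \<Longrightarrow> lin_form W (c i) = var i"
    "\<And>i j. i \<in> T \<Longrightarrow> j \<notin> T \<Longrightarrow> c i j = 0"
proof -
  have "finite T" by (rule finite_subset) fact+
  obtain U where U: "U \<subseteq> T" "indep_mod K U"
    and U_span: "\<And>i. i \<in> T - U \<Longrightarrow> \<exists>c. var i - lin_form U c \<in> K"
    using indep_mod_extend[of K T "{}", OF smult \<open>finite T\<close>] by (auto simp: indep_mod_def)
  obtain W where W: "U \<subseteq> W" "W \<subseteq> B" "indep_mod K W"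
    and W_span: "\<And>i. i \<in> B - W \<Longrightarrow> \<exists>c. var i - lin_form W c \<in> K"
    using indep_mod_extend[of K B U, OF smult \<open>finite B\<close> _ U(2)] U(1) assms(4) by auto
  have fin: "finite W" using W(2) assms(3) by (rule finite_subset)
  \<comment> \<open>On \<open>W\<close> itself the Kronecker delta is chosen, so that the expansion
    is an equality and not just a congruence modulo \<open>K\<close>.\<close>
  have delta: "lin_form W (\<lambda>j. of_bool (j = i)) = var i" if "i \<in> W" for i
  proof -
    have "lin_form W (\<lambda>j. of_bool (j = i)) = (\<Sum>j\<in>W. if j = i then var j else 0)"
      unfolding lin_form_def by (rule sum.cong) auto
    then show ?thesis using that fin by simp
  qed
  have "\<exists>c. var i - lin_form W c \<in> K \<and> (i \<in> W \<longrightarrow> lin_form W c = var i) \<and> (i \<in> T \<longrightarrow> (\<forall>j. j \<notin> T \<longrightarrow> c j = 0))"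
    if "i \<in> B" for i
  proof (cases "i \<in> W")
    case True
    then show ?thesis
      using delta[OF True] \<open>0 \<in> K\<close> by (intro exI[of _ "\<lambda>j. of_bool (j = i)"]) auto
  next
    case notW: False
    show ?thesis
    proof (cases "i \<in> T")
      case True
      then obtain c where "var i - lin_form U c \<in> K"
        using U_span[of i] notW W(1) by auto
      \<comment> \<open>The expansion over \<open>U\<close> is padded with zeros to one over
        \<open>W\<close>.\<close>
      then show ?thesis
        using notW U(1)
        by (intro exI[of _ "\<lambda>j. if j \<in> U then c j else 0"])
          (auto simp flip: lin_form_superset[OF fin W(1)])
    next
      case False
      then show ?thesis using W_span[of i] notW that by auto
    qed
  qed
  then obtain c where "\<And>i. i \<in> B \<Longrightarrow> var i - lin_form W (c i) \<in> K \<and>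
    (i \<in> W \<longrightarrow> lin_form W (c i) = var i) \<and> (i \<in> T \<longrightarrow> (\<forall>j. j \<notin> T \<longrightarrow> c i j = 0))"
    by metis
  then show ?thesis
    using that[of W c] W assms(4) by (metis subsetD)
qed


section \<open>Homomorphisms defined by substitution\<close>

text \<open>Constants and variables generate the ring: monomials are reached by induction on the
  degree, then sums of terms. Identities between ring homomorphisms can be checked on generators
  with it.\<close>

lemma poly_alg_induct [consumes 1, case_names const var add mult]:
  assumes "p \<in> carrier (poly_alg V)"
    and const: "\<And>c. P (const c)" and var: "\<And>i. i \<in> V \<Longrightarrow> P (var i)"
    and add: "\<And>p q. p \<in> carrier (poly_alg V) \<Longrightarrow> q \<in> carrier (poly_alg V) \<Longrightarrow> P p \<Longrightarrow> P q \<Longrightarrow> P (p + q)"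
    and mult: "\<And>p q. p \<in> carrier (poly_alg V) \<Longrightarrow> q \<in> carrier (poly_alg V) \<Longrightarrow> P p \<Longrightarrow> P q \<Longrightarrow> P (p * q)"
  shows "P p"
proof -
  have closed: "mon t \<in> carrier (poly_alg V)" if "Poly_Mapping.keys t \<subseteq> V" for t
    using that by (simp add: mon_def carrier_poly_alg supported_single)
  have mon: "P (mon t)" if "Poly_Mapping.keys t \<subseteq> V" for t
    using that
  proof (induction "mon_deg t" arbitrary: t rule: less_induct)
    case less
    show ?case
    proof (cases "t = 0")
      case True
      then show ?thesis using const[of 1] by simp
    next
      case False
      then obtain i where i: "i \<in> Poly_Mapping.keys t" by fastforce
      obtain s where t: "t = Poly_Mapping.single i 1 + s"
        using in_keys_split_single[OF i] by blast
      have "mon_deg s < mon_deg t"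
        by (simp add: t mon_deg_eq_wdeg wdeg_add)
      moreover have s: "Poly_Mapping.keys s \<subseteq> V" "i \<in> V"
        using less.prems i by (auto simp: t keys_add_nat)
      ultimately have "P (mon s)"
        using less.hyps by blast
      then show ?thesis
        unfolding t mon_single_add by (intro mult var) (use s closed in simp_all)
    qed
  qed
  \<comment> \<open>Membership in the carrier is carried along since \<open>add\<close> asks for
    it.\<close>
  have "(\<Sum>t\<in>B. Poly_Mapping.single t (Poly_Mapping.lookup p t)) \<in> carrier (poly_alg V) \<inter> Collect P"
    if "finite B" "B \<subseteq> Poly_Mapping.keys p" for B
    using that
  proof (induction B rule: finite_induct)
    case empty
    then show ?case using const[of 0] by (simp add: carrier_poly_alg)
  next
    case (insert t B)
    have t: "Poly_Mapping.keys t \<subseteq> V"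
      using insert.prems assms(1) by (auto simp: carrier_poly_alg supported_def)
    have "Poly_Mapping.single t a \<in> carrier (poly_alg V) \<inter> Collect P" for a
      using mult[OF _ closed[OF t] const mon[OF t]] t
      by (auto simp: single_eq_const_mult_mon[of t] closed poly_alg_mult_closed)
    then show ?case
      using insert add by (auto simp: carrier_poly_alg supported_add)
  qed
  from this[of "Poly_Mapping.keys p"] show ?thesis
    by (simp flip: poly_mapping_sum_monomials)
qed

text \<open>Opens the induction rule to arbitrary polynomials.\<close>

lemma in_poly_alg_UNIV: "p \<in> carrier (poly_alg UNIV)"
  by (simp add: carrier_poly_alg supported_def)

lemma subst_cong:
  assumes "p \<in> carrier (poly_alg V)" "\<And>i. i \<in> V \<Longrightarrow> f i = g i"
  shows "subst f p = subst g p"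
  using assms by (induction p rule: poly_alg_induct) (auto simp: subst_add subst_mult)

lemma subst_subst: "subst f (subst g p) = subst (\<lambda>i. subst f (g i)) p"
  using in_poly_alg_UNIV[of p]
  by (induction p rule: poly_alg_induct) (auto simp: subst_add subst_mult)

lemma subst_var_eq [simp]: "subst var p = p"
  using in_poly_alg_UNIV[of p]
  by (induction p rule: poly_alg_induct) (auto simp: subst_add subst_mult)

text \<open>Modulo \<open>K\<close> the substitution fixes the generators, hence everything.
  Membership in the carrier is part of the claim since the product step multiplies an element of
  \<open>K\<close> by \<open>subst g q\<close>.\<close>

lemma subst_diff_in_ideal:
  assumes "ideal K (poly_alg V)" "p \<in> carrier (poly_alg V)"
    and g: "\<And>i. i \<in> V \<Longrightarrow> g i \<in> carrier (poly_alg V)" "\<And>i. i \<in> V \<Longrightarrow> g i - var i \<in> K"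
  shows "subst g p \<in> carrier (poly_alg V) \<and> subst g p - p \<in> K"
proof -
  interpret ideal K "poly_alg V" by fact
  have zero: "0 \<in> K" and K_add: "a \<in> K \<Longrightarrow> b \<in> K \<Longrightarrow> a + b \<in> K" for a b
    using additive_subgroup.zero_closed additive_subgroup.a_closed is_additive_subgroup by force+
  show ?thesis
    using assms(2)
  proof (induction p rule: poly_alg_induct)
    case (const c)
    then show ?case using zero by simp
  next
    case (var i)
    then show ?case using g by simp
  next
    case (add p q)
    have "subst g (p + q) - (p + q) = (subst g p - p) + (subst g q - q)"
      by (simp add: subst_add)
    also have "\<dots> \<in> K"
      using add by (intro K_add) auto
    finally show ?case
      using add by (auto simp: subst_add intro: poly_alg_add_closed)
  next
    case (mult p q)
    have "subst g (p * q) - p * q = subst g q * (subst g p - p) + p * (subst g q - q)"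
      by (simp add: subst_mult algebra_simps)
    also have "\<dots> \<in> K"
      using mult I_l_closed by (intro K_add) auto
    finally show ?case
      using mult by (auto simp: subst_mult intro: poly_alg_mult_closed)
  qed
qed

text \<open>Each variable goes to a form of degree 1, so a monomial goes to a form of its own
  degree.\<close>

lemma subst_graded_alg_hom:
  assumes "\<And>i. i \<in> V \<Longrightarrow> g i \<in> poly_grading U 1"
  shows "subst g \<in> graded_alg_hom (poly_alg V) (poly_grading V) (poly_alg U) (poly_grading U)"
proof -
  have grading: "subst g p \<in> poly_grading U d" if "p \<in> poly_grading V d" for p d
    unfolding poly_grading_eq
  proof (rule subst_supported[OF that[unfolded poly_grading_eq]])
    fix t assume t: "Poly_Mapping.keys t \<subseteq> V \<and> mon_deg t = d"
    have "monom_subst g t \<in> supported ((\<lambda>d t. Poly_Mapping.keys t \<subseteq> U \<and> mon_deg t = d) (wdeg (\<lambda>_. 1) t))"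
      by (rule monom_subst_supported)
        (use t assms in \<open>auto simp: keys_add_nat wdeg_add mon_deg_eq_wdeg poly_grading_eq\<close>)
    then show "monom_subst g t \<in> supported (\<lambda>t. Poly_Mapping.keys t \<subseteq> U \<and> mon_deg t = d)"
      using t by (simp add: mon_deg_eq_wdeg)
  qed
  have "g i \<in> carrier (poly_alg U)" if "i \<in> V" for i
    using assms[OF that] by (simp add: poly_grading_def)
  note g_closed = this
  have "subst g p \<in> carrier (poly_alg U)" if "p \<in> carrier (poly_alg V)" for p
    using that
    by (induction p rule: poly_alg_induct)
      (auto simp: subst_add subst_mult g_closed intro: poly_alg_mult_closed poly_alg_add_closed)
  then show ?thesis
    using grading
    by (auto simp: graded_alg_hom_def subst_mult subst_add intro!: ring_hom_memI)
qed

section \<open>Forms of degree one\<close>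

lemma mon_deg_eq_0_iff: "mon_deg t = 0 \<longleftrightarrow> t = 0"
  by (auto simp: mon_deg_def in_keys_iff poly_mapping_eq_iff fun_eq_iff)

lemma mon_deg_eq_1_iff: "mon_deg t = 1 \<longleftrightarrow> (\<exists>i. t = Poly_Mapping.single i 1)"
proof
  assume t: "mon_deg t = 1"
  then obtain i where i: "i \<in> Poly_Mapping.keys t"
    by (fastforce simp: mon_deg_def)
  obtain s where "t = Poly_Mapping.single i 1 + s"
    using in_keys_split_single[OF i] by blast
  moreover from this have "s = 0"
    using t by (simp add: mon_deg_eq_wdeg wdeg_add flip: mon_deg_eq_0_iff)
  ultimately show "\<exists>i. t = Poly_Mapping.single i 1" by auto
qed (auto simp: mon_deg_eq_wdeg)

lemma lin_form_in_grading: "lin_form W c \<in> poly_grading W 1"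
  unfolding lin_form_def poly_grading_eq
  by (intro supported_sum supported_const_mult)
    (auto simp: var_def mon_def mon_deg_eq_wdeg intro!: supported_single)

text \<open>The exponents of degree one are the unit vectors, and the coefficients of
  \<open>p\<close> there give \<open>c\<close>. Independence modulo \<open>K\<close> thereby applies
  to every form of degree one.\<close>

lemma grading_1_lin_form:
  assumes "finite W" "p \<in> poly_grading W 1"
  obtains c where "p = lin_form W c"
proof
  let ?v = "\<lambda>i::nat. Poly_Mapping.single i (1::nat)"
  have inj: "inj_on ?v W"
    by (auto simp: inj_on_def poly_mapping_eq_iff fun_eq_iff lookup_single when_def split: if_splits)
  have "p = (\<Sum>t\<in>Poly_Mapping.keys p. Poly_Mapping.single t (Poly_Mapping.lookup p t))"
    by (rule poly_mapping_sum_monomials)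
  also have "\<dots> = (\<Sum>t\<in>?v ` W. Poly_Mapping.single t (Poly_Mapping.lookup p t))"
  proof (rule sum.mono_neutral_left)
    show "Poly_Mapping.keys p \<subseteq> ?v ` W"
    proof
      fix t assume "t \<in> Poly_Mapping.keys p"
      then have t: "Poly_Mapping.keys t \<subseteq> W" "mon_deg t = 1"
        using assms(2) by (auto simp: poly_grading_eq supported_def)
      then obtain i where "t = ?v i"
        using mon_deg_eq_1_iff by auto
      then show "t \<in> ?v ` W"
        using t(1) by auto
    qed
  qed (use assms(1) in \<open>auto simp: in_keys_iff\<close>)
  also have "\<dots> = (\<Sum>i\<in>W. Poly_Mapping.single (?v i) (Poly_Mapping.lookup p (?v i)))"
    using inj by (simp add: sum.reindex)
  also have "\<dots> = lin_form W (\<lambda>i. Poly_Mapping.lookup p (?v i))"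
    by (simp add: lin_form_def var_def mon_def mult_single)
  finally show "p = lin_form W (\<lambda>i. Poly_Mapping.lookup p (?v i))" .
qed


section \<open>Quotients of polynomial algebras\<close>

lemma quot_alg_simps [simp]:
  "carrier (quot_alg A I) = carrier (A Quot I)" "monoid.mult (quot_alg A I) = monoid.mult (A Quot I)"
  "one (quot_alg A I) = one (A Quot I)" "zero (quot_alg A I) = zero (A Quot I)"
  "add (quot_alg A I) = add (A Quot I)"
  by (simp_all add: quot_alg_def)

lemma ring_hom_quot_alg [simp]:
  "ring_hom (quot_alg A I) B = ring_hom (A Quot I) B"
  "ring_hom B (quot_alg A I) = ring_hom B (A Quot I)"
  by (simp_all add: ring_hom_def)

text \<open>A scalar multiple of a coset is defined as a union over representatives. An ideal
  absorbs constants, so all of them give the same coset; as there is at least one, the union is that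
  coset.\<close>

lemma quot_alg_smult:
  assumes "ideal J (poly_alg V)" "p \<in> carrier (poly_alg V)"
  shows "c \<odot>\<^bsub>quot_alg (poly_alg V) J\<^esub> (J +>\<^bsub>poly_alg V\<^esub> p) = J +>\<^bsub>poly_alg V\<^esub> (const c * p)"
proof -
  interpret ideal J "poly_alg V" by fact
  have "J +>\<^bsub>poly_alg V\<^esub> (const c * q) = J +>\<^bsub>poly_alg V\<^esub> (const c * p)"
    if q: "q \<in> J +>\<^bsub>poly_alg V\<^esub> p" for q
  proof -
    obtain j where j: "j \<in> J" "q = j + p"
      using q by (auto simp: a_r_coset_def')
    have "const c * j \<in> J"
      using I_l_closed[OF j(1)] by auto
    then have "const c * q \<in> J +>\<^bsub>poly_alg V\<^esub> (const c * p)"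
      by (auto simp: a_r_coset_def' j(2) distrib_left)
    then show ?thesis
      using a_repr_independence[OF _ _ a_subgroup] poly_alg_mult_closed[OF const_closed assms(2)]
      by metis
  qed
  moreover have "J +>\<^bsub>poly_alg V\<^esub> p \<noteq> {}"
    using a_rcos_self[OF assms(2)] by blast
  ultimately show ?thesis
    by (simp add: quot_alg_def)
qed

lemma projection_graded_alg_hom:
  assumes "ideal J (poly_alg V)"
  shows "(\<lambda>p. J +>\<^bsub>poly_alg V\<^esub> p) \<in> graded_alg_hom (poly_alg V) (poly_grading V)
    (quot_alg (poly_alg V) J) (quot_grading (poly_alg V) (poly_grading V) J)"
  using ideal.rcos_ring_hom[OF assms] quot_alg_smult[OF assms]
  by (auto simp: graded_alg_hom_def quot_grading_def)

lemma graded_alg_hom_closed: "f \<in> graded_alg_hom A G B H \<Longrightarrow> x \<in> carrier A \<Longrightarrow> f x \<in> carrier B"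
  by (auto simp: graded_alg_hom_def ring_hom_closed)

lemma graded_alg_hom_grading: "f \<in> graded_alg_hom A G B H \<Longrightarrow> x \<in> G i \<Longrightarrow> f x \<in> H i"
  unfolding graded_alg_hom_def by blast

lemma graded_alg_hom_compose:
  assumes "f \<in> graded_alg_hom A G B H" "g \<in> graded_alg_hom B H C L"
  shows "(\<lambda>x. g (f x)) \<in> graded_alg_hom A G C L"
proof -
  have "(\<lambda>x. g (f x)) \<in> ring_hom A C"
    using ring_hom_trans[of f A B g C] assms by (simp add: graded_alg_hom_def comp_def)
  then show ?thesis
    using assms by (fastforce simp: graded_alg_hom_def dest: ring_hom_closed)
qed


section \<open>Minimal presentations from surjections\<close>

definition hcomp :: "nat \<Rightarrow> 'k::field mpoly \<Rightarrow> 'k mpoly" where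
  "hcomp d p = (\<Sum>t | t \<in> Poly_Mapping.keys p \<and> mon_deg t = d. Poly_Mapping.single t (Poly_Mapping.lookup p t))"

lemma lookup_hcomp: "Poly_Mapping.lookup (hcomp d p) t = (if mon_deg t = d then Poly_Mapping.lookup p t else 0)"
  by (auto simp: hcomp_def lookup_sum lookup_single when_def sum.delta in_keys_iff)

lemma hcomp_in_grading:
  assumes "p \<in> carrier (poly_alg V)"
  shows "hcomp d p \<in> poly_grading V d"
  unfolding poly_grading_eq hcomp_def
  by (intro supported_sum supported_single) (use assms in \<open>auto simp: carrier_poly_alg supported_def\<close>)

lemma sum_hcomp: "p = (\<Sum>d\<in>mon_deg ` Poly_Mapping.keys p. hcomp d p)"
  using sum.image_gen[of "Poly_Mapping.keys p" "\<lambda>t. Poly_Mapping.single t (Poly_Mapping.lookup p t)" mon_deg]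
  unfolding hcomp_def by (simp flip: poly_mapping_sum_monomials)

lemma hcomp_eq_0: "d \<notin> mon_deg ` Poly_Mapping.keys p \<Longrightarrow> hcomp d p = 0"
  by (rule poly_mapping_eqI) (auto simp: lookup_hcomp in_keys_iff)

text \<open>The images of the components form a homogeneous decomposition of zero in
  \<open>A\<close>, as does the zero family; decompositions are unique.\<close>

lemma graded_alg_hom_kernel_hcomp:
  fixes h :: "'k::field mpoly \<Rightarrow> 'a"
  assumes A: "graded_algebra A G"
    and h: "h \<in> graded_alg_hom (poly_alg V) (poly_grading V) A G"
    and p: "p \<in> carrier (poly_alg V)" "h p = \<zero>\<^bsub>A\<^esub>"
  shows "h (hcomp d p) = \<zero>\<^bsub>A\<^esub>"
proof -
  have alg: "algebra (ring_of_type_algebra :: 'k ring) A"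
    using A by (simp add: graded_algebra_def)
  interpret AC: cring A
    using alg by (rule algebra.M_cring)
  interpret A: algebra "ring_of_type_algebra :: 'k ring" A
    by (rule alg)
  interpret S: cring "poly_alg V :: ('k, 'k mpoly) module" by (rule cring_poly_alg)
  interpret h: ring_hom_ring "poly_alg V" A h
    using h by (intro ring_hom_ringI2 S.ring_axioms AC.ring_axioms) (simp add: graded_alg_hom_def)
  define f where "f i = h (hcomp i p)" for i
  let ?D = "mon_deg ` Poly_Mapping.keys p"
  have comp: "hcomp i p \<in> carrier (poly_alg V)" for i
    using hcomp_in_grading[OF p(1), of i] by (simp add: poly_grading_def)
  have f: "f i \<in> G i" "f i \<in> carrier A" for i
    using graded_alg_hom_grading[OF h hcomp_in_grading[OF p(1)]] h.hom_closed[OF comp]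
    by (simp_all add: f_def)
  have "f i = \<zero>\<^bsub>A\<^esub>" if "i \<notin> ?D" for i
    using that h.hom_zero by (simp add: f_def hcomp_eq_0)
  then have supp: "{i. f i \<noteq> \<zero>\<^bsub>A\<^esub>} \<subseteq> ?D" by blast
  have "(\<Oplus>\<^bsub>poly_alg V\<^esub>i\<in>?D. hcomp i p) = p"
    using finsum_poly_alg[of "\<lambda>i. hcomp i p" ?D V] comp sum_hcomp[of p] by simp
  then have "\<zero>\<^bsub>A\<^esub> = h (\<Oplus>\<^bsub>poly_alg V\<^esub>i\<in>?D. hcomp i p)"
    using p(2) by simp
  also have "\<dots> = (\<Oplus>\<^bsub>A\<^esub>i\<in>?D. f i)"
    using h.hom_finsum[of "\<lambda>i. hcomp i p" ?D] comp by (simp add: f_def comp_def)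
  \<comment> \<open>The sum is cut down to its nonzero terms, the index set used in
    \<open>graded_algebra\<close>.\<close>
  also have "\<dots> = (\<Oplus>\<^bsub>A\<^esub>i\<in>{i. f i \<noteq> \<zero>\<^bsub>A\<^esub>}. f i)"
    using supp f by (intro AC.add.finprod_mono_neutral_cong_right) auto
  finally have f_sum: "\<zero>\<^bsub>A\<^esub> = (\<Oplus>\<^bsub>A\<^esub>i\<in>{i. f i \<noteq> \<zero>\<^bsub>A\<^esub>}. f i)" .
  have zero_G: "\<zero>\<^bsub>A\<^esub> \<in> G i" for i
    using A subgroup.one_closed[of "G i" "add_monoid A"]
    by (simp add: graded_algebra_def submodule_def)
  define Q where "Q f \<longleftrightarrow> (\<forall>i. f i \<in> G i) \<and> finite {i. f i \<noteq> \<zero>\<^bsub>A\<^esub>} \<and>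
        \<zero>\<^bsub>A\<^esub> = (\<Oplus>\<^bsub>A\<^esub>i\<in>{i. f i \<noteq> \<zero>\<^bsub>A\<^esub>}. f i)" for f
  have "finite {i. f i \<noteq> \<zero>\<^bsub>A\<^esub>}"
    using supp by (rule finite_subset) simp
  then have "Q f"
    using f_sum f(1) by (simp add: Q_def)
  moreover have "Q (\<lambda>_. \<zero>\<^bsub>A\<^esub>)"
    using zero_G by (simp add: Q_def)
  moreover have "\<exists>!f. Q f"
    using A by (simp add: graded_algebra_def Q_def)
  ultimately have "f = (\<lambda>_. \<zero>\<^bsub>A\<^esub>)"
    by blast
  then show ?thesis
    by (metis f_def)
qed

text \<open>\<open>J\<close> is the kernel of \<open>h\<close> and \<open>\<eta>\<close> the induced
  isomorphism. The kernel is homogeneous; its elements have no terms of degree 0 because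
  \<open>A\<close> is nonzero, and none of degree 1 by \<open>inj\<close>.\<close>

lemma minimal_presentation_of_surjection:
  fixes h :: "'k::field mpoly \<Rightarrow> 'a" and V :: "nat set"
  assumes V: "V = {1..m}"
    and A: "graded_algebra A G" "\<one>\<^bsub>A\<^esub> \<noteq> \<zero>\<^bsub>A\<^esub>"
    and h: "h \<in> graded_alg_hom (poly_alg V) (poly_grading V) A G"
    and surj: "carrier A \<subseteq> h ` carrier (poly_alg V)"
    and inj: "\<And>p. p \<in> poly_grading V 1 \<Longrightarrow> h p = \<zero>\<^bsub>A\<^esub> \<Longrightarrow> p = 0"
  obtains J \<eta> where "minimal_presentation A G m J \<eta>"
    "\<And>p. p \<in> carrier (poly_alg V) \<Longrightarrow> \<eta> (J +>\<^bsub>poly_alg V\<^esub> p) = h p"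
proof -
  let ?R = "poly_alg V :: ('k, 'k mpoly) module"
  have alg: "algebra (ring_of_type_algebra :: 'k ring) A"
    using A(1) by (simp add: graded_algebra_def)
  interpret AC: cring A
    using alg by (rule algebra.M_cring)
  interpret A: algebra "ring_of_type_algebra :: 'k ring" A
    by (rule alg)
  interpret R: cring ?R by (rule cring_poly_alg)
  interpret h: ring_hom_ring ?R A h
    using h by (intro ring_hom_ringI2 R.ring_axioms AC.ring_axioms) (simp add: graded_alg_hom_def)
  define J where "J = a_kernel ?R A h"
  \<comment> \<open>\<open>h\<close> is constant on cosets of its kernel, so the image of a coset is
    a singleton.\<close>
  define \<eta> where "\<eta> Y = the_elem (h ` Y)" for Y
  have J: "p \<in> J \<longleftrightarrow> p \<in> carrier ?R \<and> h p = \<zero>\<^bsub>A\<^esub>" for p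
    by (simp only: J_def a_kernel_def' mem_Collect_eq)
  interpret J: ideal J ?R
    unfolding J_def by (rule h.kernel_is_ideal)
  have \<eta>: "\<eta> (J +>\<^bsub>?R\<^esub> p) = h p" if "p \<in> carrier ?R" for p
    using h.the_elem_simp[OF that] unfolding \<eta>_def J_def .
  have hcomp_J: "hcomp d p \<in> J" "hcomp d p \<in> poly_grading V d" if "p \<in> J" for p d
    using graded_alg_hom_kernel_hcomp[OF A(1) h, of p d] hcomp_in_grading[of p V d] that
    by (simp_all add: J poly_grading_def)
  have "homogeneous_ideal ?R (poly_grading V) J"
  proof -
    let ?H = "J \<inter> (\<Union>i. poly_grading V i)"
    have H: "?H \<subseteq> carrier ?R" using J by auto
    have "p \<in> Idl\<^bsub>?R\<^esub> ?H" if "p \<in> J" for p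
    proof -
      have "(\<Sum>d\<in>mon_deg ` Poly_Mapping.keys p. hcomp d p) \<in> Idl\<^bsub>?R\<^esub> ?H"
        using hcomp_J[OF that] R.genideal_self[OF H]
        by (intro ideal_sum[OF R.genideal_ideal[OF H]]) blast
      then show ?thesis by (simp flip: sum_hcomp)
    qed
    moreover have "Idl\<^bsub>?R\<^esub> ?H \<subseteq> J"
      by (rule R.genideal_minimal[OF J.ideal_axioms]) blast
    ultimately show ?thesis
      using J.ideal_axioms by (auto simp: homogeneous_ideal_def)
  qed
  moreover have "J \<subseteq> ideal_power ?R (var_ideal V V) 2"
  proof
    fix p assume p: "p \<in> J"
    \<comment> \<open>A nonzero constant term would be a homogeneous component and hence lie in
      \<open>J\<close>; dividing by it gives 1 = 0 in \<open>A\<close>.\<close>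
    have "mon_deg t \<noteq> 0" if t: "t \<in> Poly_Mapping.keys p" for t
    proof
      assume "mon_deg t = 0"
      then have c: "Poly_Mapping.lookup p 0 \<noteq> 0" (is "?c \<noteq> 0")
        using t by (auto simp: mon_deg_eq_0_iff in_keys_iff)
      have "hcomp 0 p = const ?c"
        by (rule poly_mapping_eqI) (auto simp: lookup_hcomp mon_deg_eq_0_iff lookup_single when_def)
      then have "\<zero>\<^bsub>A\<^esub> = h (const ?c)"
        using hcomp_J(1)[OF p, of 0] J by metis
      also have "\<dots> = h (?c \<odot>\<^bsub>?R\<^esub> 1)" by simp
      also have "\<dots> = ?c \<odot>\<^bsub>A\<^esub> \<one>\<^bsub>A\<^esub>"
        using h h.hom_one R.one_closed unfolding graded_alg_hom_def by fastforce
      finally have "inverse ?c \<odot>\<^bsub>A\<^esub> (?c \<odot>\<^bsub>A\<^esub> \<one>\<^bsub>A\<^esub>) = \<zero>\<^bsub>A\<^esub>"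
        using A.smult_r_null[of "inverse ?c"] by (simp add: ring_of_type_algebra_def)
      moreover have "inverse ?c \<odot>\<^bsub>A\<^esub> (?c \<odot>\<^bsub>A\<^esub> \<one>\<^bsub>A\<^esub>) = \<one>\<^bsub>A\<^esub>"
        using A.smult_assoc1[of "inverse ?c" ?c "\<one>\<^bsub>A\<^esub>"] A.smult_one[of "\<one>\<^bsub>A\<^esub>"] c
        by (simp add: ring_of_type_algebra_def)
      ultimately show False using A(2) by simp
    qed
    moreover have "mon_deg t \<noteq> 1" if t: "t \<in> Poly_Mapping.keys p" for t
    proof
      assume "mon_deg t = 1"
      moreover have "hcomp 1 p = 0"
        using inj hcomp_J[OF p, of 1] J by blast
      ultimately show False
        using t lookup_hcomp[of 1 p t] by (simp add: in_keys_iff)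
    qed
    ultimately have "2 \<le> mon_deg t" if "t \<in> Poly_Mapping.keys p" for t
      using that by (metis less_2_cases not_less One_nat_def)
    moreover have keys: "Poly_Mapping.keys t \<subseteq> V" if "t \<in> Poly_Mapping.keys p" for t
      using p that by (auto simp: J carrier_poly_alg supported_def)
    \<comment> \<open>For the ideal of all variables, the condition defining its square is one on
      the total degree.\<close>
    moreover have "deg_in V t = mon_deg t" if "t \<in> Poly_Mapping.keys p" for t
      using keys[OF that] unfolding wdeg_def mon_deg_def by (intro sum.cong) auto
    ultimately show "p \<in> ideal_power ?R (var_ideal V V) 2"
      by (simp add: ideal_power_var_ideal supported_def)
  qed
  moreover have "\<eta> \<in> graded_alg_hom (quot_alg ?R J) (quot_grading ?R (poly_grading V) J) A G"
  proof -
    have "\<eta> \<in> ring_hom (quot_alg ?R J) A"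
      using h.the_elem_hom unfolding \<eta>_def[abs_def] J_def ring_hom_quot_alg .
    moreover have "\<eta> (c \<odot>\<^bsub>quot_alg ?R J\<^esub> Y) = c \<odot>\<^bsub>A\<^esub> \<eta> Y" if Y: "Y \<in> carrier (quot_alg ?R J)" for c Y
    proof -
      obtain p where p: "p \<in> carrier ?R" "Y = J +>\<^bsub>?R\<^esub> p"
        using Y by (auto simp: FactRing_def A_RCOSETS_def')
      have "\<eta> (c \<odot>\<^bsub>quot_alg ?R J\<^esub> Y) = h (const c * p)"
        using p by (simp add: quot_alg_smult[OF J.ideal_axioms] \<eta> poly_alg_mult_closed)
      also have "\<dots> = c \<odot>\<^bsub>A\<^esub> \<eta> Y"
        using h p \<eta> by (auto simp: graded_alg_hom_def)
      finally show ?thesis .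
    qed
    moreover have "\<eta> (J +>\<^bsub>?R\<^esub> p) \<in> G i" if "p \<in> poly_grading V i" for p i
      using graded_alg_hom_grading[OF h that] \<eta>[of p] that by (simp add: poly_grading_def)
    then have "\<eta> ` quot_grading ?R (poly_grading V) J i \<subseteq> G i" for i
      by (auto simp: quot_grading_def)
    ultimately show ?thesis by (simp add: graded_alg_hom_def)
  qed
  moreover have "bij_betw \<eta> (carrier (quot_alg ?R J)) (carrier A)"
  proof (rule bij_betw_imageI)
    show "inj_on \<eta> (carrier (quot_alg ?R J))"
      using h.the_elem_inj unfolding \<eta>_def[abs_def] J_def inj_on_def quot_alg_simps by blast
    have "\<eta> ` carrier (quot_alg ?R J) = h ` carrier ?R"
      using h.the_elem_surj unfolding \<eta>_def[abs_def] J_def quot_alg_simps .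
    then show "\<eta> ` carrier (quot_alg ?R J) = carrier A"
      using surj by auto
  qed
  ultimately have "minimal_presentation A G m J \<eta>"
    by (simp add: minimal_presentation_def V)
  then show ?thesis using that \<eta> by blast
qed


section \<open>Retracts of powers of monomial primes\<close>

theorem proposition6p5:
  fixes n d :: nat and T :: "nat set" and I :: "'k::field mpoly set"
    and A :: "('k, 'a) module" and G :: "nat \<Rightarrow> 'a set"
    and \<theta> :: "'a \<Rightarrow> 'k mpoly set" and \<pi> :: "'k mpoly set \<Rightarrow> 'a"
  assumes "T \<subseteq> {1..n}"
    and "d \<ge> 2"
    and "I = ideal_power (poly_alg {1..n}) (var_ideal {1..n} T) d"
    and "graded_retract n I A G \<theta> \<pi>"
  shows "\<exists>W. retract_base n I A G \<pi> W"
proof -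

  \<comment> \<open>The ideal and the surjection from \<open>S\<close> to \<open>A\<close>\<close>
  define V where "V = {1..n}"
  let ?S = "poly_alg V :: ('k, 'k mpoly) module"
  have I: "I = supported (\<lambda>t. Poly_Mapping.keys t \<subseteq> V \<and> d \<le> deg_in T t)"
    unfolding assms(3) V_def using assms(1) by (rule ideal_power_var_ideal)
  have idI: "ideal I ?S"
    unfolding I by (rule ideal_supported)
  have A: "graded_algebra A G"
    and \<theta>: "\<theta> \<in> graded_alg_hom A G (quot_alg ?S I) (quot_grading ?S (poly_grading V) I)"
    and \<pi>: "\<pi> \<in> graded_alg_hom (quot_alg ?S I) (quot_grading ?S (poly_grading V) I) A G"
    and \<pi>\<theta>: "\<And>a. a \<in> carrier A \<Longrightarrow> \<pi> (\<theta> a) = a"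
    using assms(4) by (simp_all add: graded_retract_def V_def)
  have ring_A: "ring A"
    using A by (auto simp: graded_algebra_def dest: algebra.M_cring intro: cring.axioms)
  have ring_S: "ring ?S"
    using cring_poly_alg by (rule cring.axioms)
  define \<rho> where "\<rho> p = \<pi> (I +>\<^bsub>?S\<^esub> p)" for p
  have \<rho>: "\<rho> \<in> graded_alg_hom ?S (poly_grading V) A G"
    unfolding \<rho>_def[abs_def] by (rule graded_alg_hom_compose[OF projection_graded_alg_hom[OF idI] \<pi>])
  \<comment> \<open>Lift \<open>\<theta> a\<close> to a representative \<open>p\<close>; the
    retraction map brings its class back to \<open>a\<close>.\<close>
  have \<rho>_surj: "carrier A \<subseteq> \<rho> ` carrier ?S"
  proof
    fix a assume a: "a \<in> carrier A"
    have "\<theta> a \<in> carrier (?S Quot I)"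
      using graded_alg_hom_closed[OF \<theta> a] by simp
    then obtain p where p: "p \<in> carrier ?S" "\<theta> a = I +>\<^bsub>?S\<^esub> p"
      by (auto simp: FactRing_def A_RCOSETS_def')
    then have "a = \<rho> p"
      using \<pi>\<theta>[OF a] by (simp add: \<rho>_def)
    with p(1) show "a \<in> \<rho> ` carrier ?S" by blast
  qed
  \<comment> \<open>If 1 = 0 in \<open>A\<close>, applying \<open>\<theta>\<close> puts 1 into
    \<open>I\<close>; but the monomial 1 has degree 0 in \<open>T\<close> and \<open>d\<close> is
    positive.\<close>
  have nontriv: "\<one>\<^bsub>A\<^esub> \<noteq> \<zero>\<^bsub>A\<^esub>"
  proof
    assume "\<one>\<^bsub>A\<^esub> = \<zero>\<^bsub>A\<^esub>"
    moreover have "\<theta> \<in> ring_hom A (?S Quot I)"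
      using \<theta> by (simp add: graded_alg_hom_def)
    ultimately have "\<one>\<^bsub>?S Quot I\<^esub> = \<zero>\<^bsub>?S Quot I\<^esub>"
      using ring_hom_one ring_hom_zero[OF _ ring_A ideal.quotient_is_ring[OF idI]] by metis
    then have "I +>\<^bsub>?S\<^esub> 1 = I"
      by (simp add: FactRing_def)
    then have "1 \<in> I"
      using ideal.rcos_const_imp_mem[OF idI, of 1] const_closed[of 1 V] by simp
    then show False
      using assms(2) by (simp add: I supported_def)
  qed

  \<comment> \<open>The kernel and the choice of \<open>W\<close>\<close>
  define K where "K = a_kernel ?S A \<rho>"
  have K: "p \<in> K \<longleftrightarrow> p \<in> carrier ?S \<and> \<rho> p = \<zero>\<^bsub>A\<^esub>" for p
    by (simp only: K_def a_kernel_def' mem_Collect_eq)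
  have hom_\<rho>: "ring_hom_ring ?S A \<rho>"
    using \<rho> by (intro ring_hom_ringI2 ring_S ring_A) (simp add: graded_alg_hom_def)
  have idK: "ideal K ?S"
    unfolding K_def using hom_\<rho> by (rule ring_hom_ring.kernel_is_ideal)
  have K_smult: "const a * p \<in> K" if "p \<in> K" for a p
    using ideal.I_l_closed[OF idK that, of "const a"] by simp
  have K_0: "0 \<in> K"
    using additive_subgroup.zero_closed[OF ideal.axioms(1)[OF idK]] by simp
  obtain W c where W: "W \<subseteq> V" "indep_mod K W"
    and c: "\<And>i. i \<in> V \<Longrightarrow> var i - lin_form W (c i) \<in> K"
    and c_W: "\<And>i. i \<in> W \<Longrightarrow> lin_form W (c i) = var i"
    and c_T: "\<And>i j. i \<in> T \<Longrightarrow> j \<notin> T \<Longrightarrow> c i j = 0"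
    using adapted_basis[OF K_smult K_0, of V T] assms(1) by (auto simp: V_def)
  have fin: "finite W"
    using W(1) by (rule finite_subset) (simp add: V_def)
  define m where "m = card W"
  define U where "U = {1..m}"
  let ?R = "poly_alg U :: ('k, 'k mpoly) module"
  \<comment> \<open>Minimal presentations use the variables with indices from 1 to \<open>m\<close>,
    so \<open>W\<close> is enumerated by \<open>e'\<close>, with inverse \<open>e\<close>.\<close>
  obtain e' where e': "bij_betw e' U W"
    using ex_bij_betw_nat_finite_1[OF fin] by (auto simp: U_def m_def)
  define e where "e = inv_into U e'"
  have ee': "e (e' j) = j" "e' j \<in> W" if "j \<in> U" for j
    using that e' by (auto simp: e_def bij_betw_def inv_into_f_f)
  have e'e: "e' (e i) = i" "e i \<in> U" if "i \<in> W" for i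
    using that e' by (auto simp: e_def bij_betw_def f_inv_into_f inv_into_into)

  \<comment> \<open>The map \<open>\<phi>\<close> and its section \<open>\<psi>\<close>\<close>
  define \<alpha> :: "'k mpoly \<Rightarrow> 'k mpoly" where "\<alpha> = subst (\<lambda>i. var (e i))"
  define \<psi> :: "'k mpoly \<Rightarrow> 'k mpoly" where "\<psi> = subst (\<lambda>j. var (e' j))"
  \<comment> \<open>The expansion of \<open>x_i\<close> lies in \<open>S_W\<close>;
    \<open>\<alpha>\<close> renames it into a form of \<open>R\<close>, and \<open>\<psi>\<close>
    undoes this renaming.\<close>
  define \<phi> where "\<phi> = subst (\<lambda>i. \<alpha> (lin_form W (c i)))"
  define \<sigma> where "\<sigma> = subst (\<lambda>i. lin_form W (c i))"
  have var_grading: "(var i :: 'k mpoly) \<in> poly_grading B 1" if "i \<in> B" for i B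
    using that by (auto simp: poly_grading_eq var_def mon_def mon_deg_eq_wdeg intro!: supported_single)
  have \<alpha>: "\<alpha> \<in> graded_alg_hom (poly_alg W) (poly_grading W) ?R (poly_grading U)"
    unfolding \<alpha>_def by (intro subst_graded_alg_hom var_grading e'e)
  \<comment> \<open>\<open>\<psi>\<close> is recorded with target \<open>S_W\<close>, to obtain
    linear forms in \<open>W\<close>, and then with target \<open>S\<close>, to compose it with
    \<open>\<rho>\<close>.\<close>
  have \<psi>_W: "\<psi> \<in> graded_alg_hom ?R (poly_grading U) (poly_alg W) (poly_grading W)"
    unfolding \<psi>_def by (intro subst_graded_alg_hom var_grading ee')
  have \<psi>_V: "\<psi> \<in> graded_alg_hom ?R (poly_grading U) ?S (poly_grading V)"
    unfolding \<psi>_def using W(1) by (intro subst_graded_alg_hom var_grading) (auto dest: ee')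
  have \<alpha>_lin: "\<alpha> (lin_form W b) \<in> poly_grading U 1" for b
    using \<alpha> lin_form_in_grading by (rule graded_alg_hom_grading)
  have \<phi>: "\<phi> \<in> graded_alg_hom ?S (poly_grading V) ?R (poly_grading U)"
    unfolding \<phi>_def by (intro subst_graded_alg_hom \<alpha>_lin)
  have lin_closed: "lin_form W b \<in> carrier (poly_alg W)" for b
    using lin_form_in_grading[of W b] by (simp add: poly_grading_def)
  have \<psi>\<alpha>: "\<psi> (\<alpha> p) = p" if "p \<in> carrier (poly_alg W)" for p
  proof -
    have "\<psi> (\<alpha> p) = subst var p"
      unfolding \<psi>_def \<alpha>_def subst_subst using that by (rule subst_cong) (simp add: e'e)
    then show ?thesis by simp
  qed
  have \<psi>\<phi>: "\<psi> (\<phi> p) = \<sigma> p" for p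
    using \<psi>\<alpha>[OF lin_closed] by (simp add: \<phi>_def \<sigma>_def \<psi>_def subst_subst)
  \<comment> \<open>This is an identity in \<open>R\<close> itself, because by \<open>c_W\<close>
    the expansion of a variable of \<open>W\<close> is that variable.\<close>
  have \<phi>\<psi>: "\<phi> (\<psi> q) = q" if "q \<in> carrier ?R" for q
  proof -
    have "\<phi> (\<psi> q) = subst var q"
      unfolding \<psi>_def \<phi>_def subst_subst using that
      by (rule subst_cong) (simp add: c_W ee' \<alpha>_def)
    then show ?thesis by simp
  qed
  have \<sigma>_K: "\<sigma> p \<in> carrier ?S \<and> \<sigma> p - p \<in> K" if "p \<in> carrier ?S" for p
    unfolding \<sigma>_def
  proof (rule subst_diff_in_ideal[OF idK that])
    fix i assume i: "i \<in> V"
    show "lin_form W (c i) \<in> carrier ?S"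
      using lin_closed[of "c i"] W(1) by (auto simp: carrier_poly_alg elim!: supported_mono)
    show "lin_form W (c i) - var i \<in> K"
      using K_smult[OF c[OF i], of "-1"] by (simp add: single_uminus)
  qed
  \<comment> \<open>\<open>\<sigma>\<close> is the identity modulo the kernel of
    \<open>\<rho>\<close>.\<close>
  have \<rho>\<sigma>: "\<rho> (\<sigma> p) = \<rho> p" if p: "p \<in> carrier ?S" for p
  proof -
    have K': "\<rho> (\<sigma> p - p) = \<zero>\<^bsub>A\<^esub>" "\<sigma> p - p \<in> carrier ?S"
      using \<sigma>_K[OF p] K by auto
    have "\<rho> \<in> ring_hom ?S A"
      using hom_\<rho> by (rule ring_hom_ring.homh)
    from ring_hom_add[OF this K'(2) p] have "\<rho> (\<sigma> p) = \<zero>\<^bsub>A\<^esub> \<oplus>\<^bsub>A\<^esub> \<rho> p"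
      by (simp add: K'(1))
    then show ?thesis
      using graded_alg_hom_closed[OF \<rho> p] ring_A by (simp add: ring.ring_simprules)
  qed

  \<comment> \<open>The minimal presentation of \<open>A\<close> over \<open>R\<close>\<close>
  obtain J \<eta> where pres: "minimal_presentation A G m J \<eta>"
    and \<eta>: "\<And>p. p \<in> carrier ?R \<Longrightarrow> \<eta> (J +>\<^bsub>?R\<^esub> p) = \<rho> (\<psi> p)"
  proof (rule minimal_presentation_of_surjection[OF U_def A nontriv graded_alg_hom_compose[OF \<psi>_V \<rho>]])
    \<comment> \<open>A preimage of \<open>\<rho> p\<close> is \<open>\<phi> p\<close>, since
      \<open>\<psi>\<close> after \<open>\<phi>\<close> is \<open>\<sigma>\<close> and
      \<open>\<sigma>\<close> does not change the value of \<open>\<rho>\<close>.\<close>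
    show "carrier A \<subseteq> (\<lambda>q. \<rho> (\<psi> q)) ` carrier ?R"
    proof
      fix a assume "a \<in> carrier A"
      then obtain p where p: "p \<in> carrier ?S" "a = \<rho> p"
        using \<rho>_surj by blast
      then have "a = \<rho> (\<psi> (\<phi> p))"
        by (simp add: \<psi>\<phi> \<rho>\<sigma>)
      moreover have "\<phi> p \<in> carrier ?R"
        using \<phi> p(1) by (rule graded_alg_hom_closed)
      ultimately show "a \<in> (\<lambda>q. \<rho> (\<psi> q)) ` carrier ?R" by blast
    qed
    \<comment> \<open>\<open>\<psi>\<close> carries \<open>q\<close> to a linear form in
      \<open>W\<close> that lies in \<open>K\<close>; independence makes this form vanish, and
      \<open>\<phi>\<close> recovers \<open>q\<close>.\<close>
    fix q assume q: "q \<in> poly_grading U 1" "\<rho> (\<psi> q) = \<zero>\<^bsub>A\<^esub>"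
    have "\<psi> q \<in> poly_grading W 1" "\<psi> q \<in> poly_grading V 1"
      by (rule graded_alg_hom_grading, rule \<psi>_W \<psi>_V, rule q(1))+
    moreover from this obtain b where b: "\<psi> q = lin_form W b"
      using grading_1_lin_form[OF fin] by blast
    ultimately have "lin_form W b \<in> K"
      using q(2) by (simp add: K poly_grading_def)
    then have "\<forall>i\<in>W. b i = 0"
      using W(2) by (simp add: indep_mod_def)
    then have "lin_form W b = 0"
      by (simp add: lin_form_def)
    then have "\<phi> (\<psi> q) = 0"
      by (simp add: b \<phi>_def)
    then show "q = 0"
      using \<phi>\<psi>[of q] q(1) by (simp add: poly_grading_def)
  qed (rule that)
  \<comment> \<open>Both sides equal \<open>\<rho> p\<close>, because
    \<open>\<rho> (\<psi> (\<phi> p)) = \<rho> (\<sigma> p)\<close>.\<close>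
  have induces: "induces_retraction n I m J \<eta> \<pi> \<phi>"
    unfolding induces_retraction_def V_def[symmetric] U_def[symmetric]
  proof (intro conjI \<phi> ballI)
    fix p assume p: "p \<in> carrier ?S"
    have "\<phi> p \<in> carrier ?R"
      using \<phi> p by (rule graded_alg_hom_closed)
    then show "\<eta> (J +>\<^bsub>?R\<^esub> \<phi> p) = \<pi> (I +>\<^bsub>?S\<^esub> p)"
      using p by (simp add: \<eta> \<psi>\<phi> \<rho>\<sigma>) (simp add: \<rho>_def)
  qed

  \<comment> \<open>Linear independence of the images of the variables in \<open>W\<close>\<close>
  have \<phi>_var: "\<phi> (var i) = var (e i)" if "i \<in> W" for i
    using that by (simp add: \<phi>_def c_W \<alpha>_def)
  \<comment> \<open>A relation is the image under \<open>\<alpha>\<close> of a linear form in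
    \<open>W\<close>; applying \<open>\<psi>\<close> shows that this form is zero, so it lies in
    \<open>K\<close>.\<close>
  have indep: "\<forall>i\<in>W. b i = 0" if b: "(\<Oplus>\<^bsub>?R\<^esub>i\<in>W. b i \<odot>\<^bsub>?R\<^esub> \<phi> (var i)) = \<zero>\<^bsub>?R\<^esub>" for b
  proof -
    have "(\<Oplus>\<^bsub>?R\<^esub>i\<in>W. b i \<odot>\<^bsub>?R\<^esub> \<phi> (var i)) = (\<Sum>i\<in>W. const (b i) * \<phi> (var i))"
      using finsum_poly_alg[of "\<lambda>i. const (b i) * \<phi> (var i)" W U] fin
      by (simp add: \<phi>_var e'e poly_alg_mult_closed Pi_def)
    also have "\<dots> = \<alpha> (lin_form W b)"
      by (simp add: lin_form_def \<alpha>_def subst_sum subst_mult \<phi>_var)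
    finally have "\<alpha> (lin_form W b) = 0"
      using b by simp
    then have "lin_form W b = 0"
      using \<psi>\<alpha>[OF lin_closed, of b] by (simp add: \<psi>_def)
    then show ?thesis
      using W(2) K_0 by (simp add: indep_mod_def)
  qed

  \<comment> \<open>Equality of the images of \<open>I\<close> and \<open>I_W S\<close>\<close>
  let ?gen = "{mon t | t. Poly_Mapping.keys t \<subseteq> W \<and> mon t \<in> I}"
  \<comment> \<open>This is the intersection of \<open>I\<close> with \<open>S_W\<close>, described
    by exponents.\<close>
  let ?F = "supported (\<lambda>t. Poly_Mapping.keys t \<subseteq> W \<and> d \<le> deg_in T t) :: 'k mpoly set"
  interpret S: cring ?S by (rule cring_poly_alg)
  interpret S_W: cring "poly_alg W :: ('k, 'k mpoly) module" by (rule cring_poly_alg)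
  have mon_I: "mon t \<in> I \<longleftrightarrow> Poly_Mapping.keys t \<subseteq> V \<and> d \<le> deg_in T t" for t
    by (simp add: I supported_def mon_def)
  have F_I: "?F \<subseteq> I"
    unfolding I using W(1) by (auto elim!: supported_mono)
  have restrict_F: "restrict_ideal I W \<subseteq> ?F"
    unfolding restrict_ideal_def
    by (rule S_W.genideal_minimal[OF ideal_supported])
      (auto simp: mon_I[simplified mon_def] mon_def intro!: supported_single)
  have restrict_S: "restrict_ideal I W \<subseteq> carrier ?S"
    using restrict_F F_I ideal.Icarr[OF idI] by blast
  let ?IWS = "Idl\<^bsub>?S\<^esub> (restrict_ideal I W)"
  \<comment> \<open>\<open>?F\<close> is spanned by its monomials, so this suffices to place it
    inside \<open>I_W S\<close>.\<close>
  have gen_S: "mon t \<in> ?IWS" if "Poly_Mapping.keys t \<subseteq> W \<and> d \<le> deg_in T t" for t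
  proof -
    have "?gen \<subseteq> carrier (poly_alg W)"
      by (auto simp: mon_def carrier_poly_alg intro!: supported_single)
    moreover have "mon t \<in> ?gen"
      using that W(1) mon_I[of t] by blast
    ultimately have "mon t \<in> restrict_ideal I W"
      unfolding restrict_ideal_def using S_W.genideal_self by blast
    then show ?thesis
      using S.genideal_self[OF restrict_S] by blast
  qed
  \<comment> \<open>For \<open>i\<close> in \<open>T\<close> only variables of \<open>T\<close>
    occur in the expansion of \<open>x_i\<close>, so each term has degree at least 1 in
    \<open>T\<close>; for other \<open>i\<close> the bound is 0. Hence the substitution cannot lower
    the degree in \<open>T\<close>.\<close>
  have \<sigma>_I: "\<sigma> p \<in> ?F" if "p \<in> I" for p
    unfolding \<sigma>_def
  proof (rule subst_supported[OF that[unfolded I]])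
    fix t assume t: "Poly_Mapping.keys t \<subseteq> V \<and> d \<le> deg_in T t"
    have "lin_form W (c i) \<in> supported (\<lambda>s. Poly_Mapping.keys s \<subseteq> W \<and> of_bool (i \<in> T) \<le> deg_in T s)" for i
      unfolding lin_form_def
    proof (rule supported_sum)
      fix j assume "j \<in> W"
      then show "const (c i j) * var j \<in> supported (\<lambda>s. Poly_Mapping.keys s \<subseteq> W \<and> of_bool (i \<in> T) \<le> deg_in T s)"
        using c_T[of i j]
        by (cases "c i j = 0"; cases "j \<in> T") (auto simp: var_def mon_def intro!: supported_const_mult supported_single)
    qed
    then have "monom_subst (\<lambda>i. lin_form W (c i)) t
        \<in> supported ((\<lambda>a s. Poly_Mapping.keys s \<subseteq> W \<and> a \<le> deg_in T s) (deg_in T t))"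
      by (intro monom_subst_supported) (auto simp: keys_add_nat wdeg_add)
    then show "monom_subst (\<lambda>i. lin_form W (c i)) t \<in> ?F"
      using t by (auto elim: supported_mono)
  qed
  have "\<phi> ` I = \<phi> ` ?IWS"
  proof
    show "\<phi> ` ?IWS \<subseteq> \<phi> ` I"
      using S.genideal_minimal[OF idI] restrict_F F_I by blast
    show "\<phi> ` I \<subseteq> \<phi> ` ?IWS"
    proof
      fix q assume "q \<in> \<phi> ` I"
      then obtain p where p: "p \<in> I" "q = \<phi> p" by blast
      have "p \<in> carrier ?S"
        using p(1) by (rule ideal.Icarr[OF idI])
      then have "q \<in> carrier ?R"
        unfolding p(2) by (rule graded_alg_hom_closed[OF \<phi>])
      then have "q = \<phi> (\<sigma> p)"
        using \<phi>\<psi> \<psi>\<phi> p(2) by metis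
      moreover have "\<sigma> p \<in> ?IWS"
        by (rule ideal_contains_supported[OF S.genideal_ideal[OF restrict_S] \<sigma>_I[OF p(1)] gen_S])
      ultimately show "q \<in> \<phi> ` ?IWS" by blast
    qed
  qed
  then have "retract_base n I A G \<pi> W"
    unfolding retract_base_def V_def[symmetric]
    using W(1) pres induces indep[unfolded U_def] by blast
  then show ?thesis ..
qed

end
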